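(* Let $\mathcal{A},\mathcal{B},\mathcal{C}$ be finite-dimensional unital $C^*$-algebras and let $G:\mathcal{A}\to\mathcal{B}$ and $\xi:\mathcal{B}\to\mathcal{C}$ be Schwarz-positive unital (SPU) maps. Suppose that $G(A^*A)-G(A)^*G(A)\in\ker\xi$ for some $A\in\mathcal{A}$. Then, for this $A$, $$G(A^*D)-G(A)^*G(D)\in\ker\xi\quad\text{and}\quad G(D^*A)-G(D)^*G(A)\in\ker\xi\qquad\text{for all }D\in\mathcal{A}.$$
   Context: A linear map $F:\mathcal{B}\to\mathcal{A}$ of unital $C^*$-algebras is Schwarz-positive unital (SPU) if it is unital and $F(B^*B)\ge F(B)^*F(B)$ for all $B\in\mathcal{B}$. *)

theory Defs
  imports Complex_Main
begin

text \<open>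
  The unit comes from \<open>monoid_mult\<close> rather than \<open>ring_1\<close> so that the zero algebra is not excluded;
  in a nonzero algebra \<open>norm 1 = 1\<close> follows from the last axiom.
  Scalar multiplication by complex numbers extends the real one inherited from \<open>real_normed_algebra\<close>.
\<close>

class unital_cstar_algebra = real_normed_algebra + monoid_mult + banach +
  fixes scaleC :: "complex \<Rightarrow> 'a \<Rightarrow> 'a"  (infixr "*\<^sub>C" 75)
    and star :: "'a \<Rightarrow> 'a"  ("_\<^sup>\<star>" [1000] 1000)
  assumes scaleR_scaleC: "r *\<^sub>R x = complex_of_real r *\<^sub>C x"
    and scaleC_add_right: "c *\<^sub>C (x + y) = c *\<^sub>C x + c *\<^sub>C y"
    and scaleC_add_left: "(c + d) *\<^sub>C x = c *\<^sub>C x + d *\<^sub>C x"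
    and scaleC_scaleC: "c *\<^sub>C (d *\<^sub>C x) = (c * d) *\<^sub>C x"
    and scaleC_one: "1 *\<^sub>C x = x"
    and mult_scaleC_left: "(c *\<^sub>C x) * y = c *\<^sub>C (x * y)"
    and mult_scaleC_right: "x * (c *\<^sub>C y) = c *\<^sub>C (x * y)"
    and norm_scaleC: "norm (c *\<^sub>C x) = cmod c * norm x"
    and star_add: "(x + y)\<^sup>\<star> = x\<^sup>\<star> + y\<^sup>\<star>"
    and star_scaleC: "(c *\<^sub>C x)\<^sup>\<star> = cnj c *\<^sub>C x\<^sup>\<star>"
    and star_mult: "(x * y)\<^sup>\<star> = y\<^sup>\<star> * x\<^sup>\<star>"
    and star_star: "(x\<^sup>\<star>)\<^sup>\<star> = x"
    and norm_star_mult_self: "norm (x\<^sup>\<star> * x) = (norm x)\<^sup>2"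

global_interpretation complex_vector:
  vector_space "scaleC :: complex \<Rightarrow> 'a \<Rightarrow> 'a::unital_cstar_algebra"
  by unfold_locales
    (simp_all add: scaleC_add_right scaleC_add_left scaleC_scaleC scaleC_one)

class fin_dim_unital_cstar_algebra = unital_cstar_algebra +
  assumes finite_complex_spanning_set: "\<exists>B. finite B \<and> (\<forall>x. \<exists>c. x = (\<Sum>b\<in>B. c b *\<^sub>C b))"

definition cstar_positive :: "'a::unital_cstar_algebra \<Rightarrow> bool"
  where "cstar_positive x \<longleftrightarrow> (\<exists>y. x = y\<^sup>\<star> * y)"

definition cstar_le :: "'a::unital_cstar_algebra \<Rightarrow> 'a \<Rightarrow> bool"  (infix "\<le>\<^sub>C" 50)
  where "x \<le>\<^sub>C y \<longleftrightarrow> cstar_positive (y - x)"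

definition SPU :: "('b::unital_cstar_algebra \<Rightarrow> 'a::unital_cstar_algebra) \<Rightarrow> bool"
  where "SPU F \<longleftrightarrow> Vector_Spaces.linear scaleC scaleC F \<and> F 1 = 1 \<and>
    (\<forall>B. (F B)\<^sup>\<star> * F B \<le>\<^sub>C F (B\<^sup>\<star> * B))"

definition ker :: "('b \<Rightarrow> 'c::zero) \<Rightarrow> 'b set"
  where "ker f = {x. f x = 0}"

end

theory Submission
  imports Defs "Jordan_Normal_Form.Schur_Decomposition"
begin

text \<open>
  The form \<open>S D E = \<xi> (G (D\<^sup>\<star> * E) - (G D)\<^sup>\<star> * G E)\<close> is sesquilinear, Hermitian, and each \<open>S D D\<close> is a
  sum of two squares, by the Schwarz inequalities of \<open>G\<close> and \<open>\<xi>\<close>. If \<open>S A A = 0\<close>, then expanding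
  \<open>S (t A + D) (t A + D)\<close> shows that the whole real line \<open>t (S A D + S D A) + S D D\<close> consists of
  sums of squares, which forces \<open>S A D + S D A = 0\<close>; replacing \<open>D\<close> by \<open>\<i> D\<close> gives \<open>S A D = 0\<close>.

  That the cone of sums of squares contains no line is seen with a faithful positive trace, so that
  neither functional calculus nor the positivity of sums of squares is needed. The trace is that of
  the left regular representation: self-adjoint elements have real eigenvalues, hence
  \<open>\<tau> (a * a) \<ge> 0\<close>, and by cyclicity \<open>4 \<tau> (x\<^sup>\<star> * x) = \<tau> (u * u) + \<tau> (v * v)\<close> for the self-adjoint
  \<open>u = x + x\<^sup>\<star>\<close> and \<open>v = \<i> (x - x\<^sup>\<star>)\<close>.
\<close>

section \<open>The involution on elementary expressions\<close>

lemma star_zero [simp]: "(0::'a::unital_cstar_algebra)\<^sup>\<star> = 0"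
  using star_add[of "0::'a" 0] by simp

lemma star_one [simp]: "(1::'a::unital_cstar_algebra)\<^sup>\<star> = 1"
  by (metis mult.right_neutral star_mult star_star)

lemma star_minus: "(- x)\<^sup>\<star> = - (x::'a::unital_cstar_algebra)\<^sup>\<star>"
  using star_add[of x "- x"] by (simp add: eq_neg_iff_add_eq_0 add.commute)

lemma star_diff: "(x - y)\<^sup>\<star> = (x::'a::unital_cstar_algebra)\<^sup>\<star> - y\<^sup>\<star>"
  using star_add[of x "- y"] by (simp add: star_minus)

lemma star_scaleR: "(r *\<^sub>R x)\<^sup>\<star> = r *\<^sub>R (x::'a::unital_cstar_algebra)\<^sup>\<star>"
  by (simp add: scaleR_scaleC star_scaleC)

section \<open>Norms and eigenvalues of self-adjoint elements\<close>

text \<open>Powers of \<open>a\<close> are again self-adjoint, so the C*-identity applied to such a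
  power squares the norm whenever the exponent doubles.\<close>

lemma norm_self_adjoint_power:
  fixes a :: "'a::unital_cstar_algebra"
  assumes "a\<^sup>\<star> = a"
  shows "norm (a ^ 2 ^ n) = norm a ^ 2 ^ n"
proof -
  have sa: "(a ^ k)\<^sup>\<star> = a ^ k" for k
    by (induction k) (simp_all add: assms star_mult power_commutes)
  show ?thesis
  proof (induction n)
    case (Suc n)
    have "norm (a ^ 2 ^ Suc n) = norm ((a ^ 2 ^ n)\<^sup>\<star> * a ^ 2 ^ n)"
      by (simp add: sa flip: power_add mult_2)
    also have "\<dots> = (norm a ^ 2 ^ n)\<^sup>2"
      by (simp only: norm_star_mult_self Suc)
    finally show ?case
      by (simp add: mult.commute flip: power_mult)
  qed simp
qed

text \<open>The norm is known to be multiplicative on powers with exponent a power of two, so the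
  vanishing exponent \<open>n\<close> is raised to \<open>2 ^ n\<close>.\<close>

lemma self_adjoint_nilpotent_eq_0:
  fixes a :: "'a::unital_cstar_algebra"
  assumes "a\<^sup>\<star> = a" "a ^ n = 0"
  shows "a = 0"
proof -
  have "n \<le> 2 ^ n"
    by (simp add: less_imp_le)
  then have "a ^ 2 ^ n = a ^ n * a ^ (2 ^ n - n)"
    by (simp flip: power_add)
  with assms norm_self_adjoint_power[of a n] show ?thesis
    by simp
qed

text \<open>The C*-identity makes the norm of the unit idempotent. It is 0 in the zero algebra and 1
  otherwise, whence an inequality.\<close>

lemma norm_one_le: "norm (1::'a::unital_cstar_algebra) \<le> 1"
proof -
  have "norm (1::'a) = (norm (1::'a))\<^sup>2"
    using norm_star_mult_self[of "1::'a"] by simp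
  then show ?thesis
    by (cases "norm (1::'a) = 0") (simp_all add: power2_eq_square)
qed

text \<open>Adding the scalar i t to \<open>a\<close> adds i t to the eigenvalue, whose modulus is
  bounded by the norm. By the C*-identity the squared norm exceeds \<open>(norm a)\<^sup>2\<close>
  by at most t^2. Hence the part of the squared modulus linear in t, with slope
  \<open>2 * Im k\<close>, is bounded above for all real t.\<close>

lemma self_adjoint_eigenvalue_real:
  fixes a w :: "'a::unital_cstar_algebra"
  assumes a: "a\<^sup>\<star> = a" and w: "w \<noteq> 0" "a * w = k *\<^sub>C w"
  shows "k \<in> \<real>"
proof -
  have bound: "(Re k)\<^sup>2 + (Im k + t)\<^sup>2 \<le> (norm a)\<^sup>2 + t\<^sup>2" for t :: real
  proof -
    define z where "z = a + (\<i> * complex_of_real t) *\<^sub>C 1"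
    have "z\<^sup>\<star> * z = a * a + (t\<^sup>2) *\<^sub>R 1"
      by (simp add: z_def a star_add star_scaleC algebra_simps mult_scaleC_left mult_scaleC_right
          scaleC_scaleC scaleR_scaleC power2_eq_square)
    then have "(norm z)\<^sup>2 \<le> norm (a * a) + t\<^sup>2 * norm (1::'a)"
      using norm_triangle_ineq[of "a * a" "t\<^sup>2 *\<^sub>R 1"] by (simp flip: norm_star_mult_self)
    also have "\<dots> \<le> (norm a)\<^sup>2 + t\<^sup>2"
      using norm_mult_ineq[of a a] norm_one_le[where 'a = 'a]
      by (intro add_mono) (simp_all add: power2_eq_square mult_left_le)
    finally have z: "(norm z)\<^sup>2 \<le> (norm a)\<^sup>2 + t\<^sup>2" .
    have "z * w = (k + \<i> * complex_of_real t) *\<^sub>C w"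
      by (simp add: z_def w distrib_right mult_scaleC_left scaleC_add_left)
    then have "cmod (k + \<i> * complex_of_real t) * norm w \<le> norm z * norm w"
      using norm_mult_ineq[of z w] by (simp add: norm_scaleC)
    then have "cmod (k + \<i> * complex_of_real t) \<le> norm z"
      using w by simp
    then have "(cmod (k + \<i> * complex_of_real t))\<^sup>2 \<le> (norm z)\<^sup>2"
      by (simp add: power_mono)
    with z show ?thesis
      by (simp add: cmod_power2)
  qed
  have "Im k = 0"
  proof (rule ccontr)
    assume nz: "Im k \<noteq> 0"
    \<comment> \<open>Once t^2 cancels in \<open>bound\<close>, this value makes the linear term
      exceed \<open>(norm a)\<^sup>2\<close> by one.\<close>
    define t where "t = ((norm a)\<^sup>2 + 1) / (2 * Im k)"
    have "2 * Im k * t = (norm a)\<^sup>2 + 1"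
      using nz by (simp add: t_def)
    moreover have "(Re k)\<^sup>2 + (Im k)\<^sup>2 + 2 * Im k * t \<le> (norm a)\<^sup>2"
      using bound[of t] by (simp add: power2_eq_square algebra_simps)
    ultimately show False
      by (smt (verit) zero_le_power2)
  qed
  then show ?thesis
    by (simp add: complex_is_Real_iff)
qed

section \<open>Traces and real spectra of complex matrices\<close>

definition mat_trace :: "'a::comm_ring_1 mat \<Rightarrow> 'a"
  where "mat_trace A = (\<Sum>i<dim_row A. A $$ (i, i))"

lemma mat_trace_mult_commute:
  assumes "A \<in> carrier_mat n n" "B \<in> carrier_mat n n"
  shows "mat_trace (A * B) = mat_trace (B * A)"
proof -
  have "mat_trace (A * B) = (\<Sum>i<n. \<Sum>j<n. A $$ (i, j) * B $$ (j, i))"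
    using assms by (auto simp: mat_trace_def scalar_prod_def lessThan_atLeast0 intro!: sum.cong)
  also have "\<dots> = (\<Sum>j<n. \<Sum>i<n. B $$ (j, i) * A $$ (i, j))"
    by (subst sum.swap) (simp add: mult.commute)
  also have "\<dots> = mat_trace (B * A)"
    using assms by (auto simp: mat_trace_def scalar_prod_def lessThan_atLeast0 intro!: sum.cong)
  finally show ?thesis .
qed

text \<open>Cyclicity brings \<open>Q\<close> to the front of \<open>P * B * Q\<close>, where it
  cancels \<open>P\<close>.\<close>

lemma mat_trace_similar:
  assumes "similar_mat A B"
  shows "mat_trace A = mat_trace B"
proof -
  obtain n P Q where carr: "{A, B, P, Q} \<subseteq> carrier_mat n n"
    and QP: "Q * P = 1\<^sub>m n" and A: "A = P * B * Q"
    using similar_matD[OF assms] by auto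
  then have "mat_trace A = mat_trace (Q * (P * B))"
    using mat_trace_mult_commute[of "P * B" n Q] by auto
  also have "Q * (P * B) = B"
    using carr QP left_mult_one_mat[of B n n] by (simp flip: assoc_mult_mat[of Q n n P n B n])
  finally show ?thesis .
qed

lemma upper_triangular_square_diag:
  fixes B :: "'a::semiring_1 mat"
  assumes "B \<in> carrier_mat n n" "upper_triangular B" "i < n"
  shows "(B * B) $$ (i, i) = (B $$ (i, i))\<^sup>2"
proof -
  have "(B * B) $$ (i, i) = (\<Sum>j<n. B $$ (i, j) * B $$ (j, i))"
    using assms by (simp add: scalar_prod_def lessThan_atLeast0)
  also have "\<dots> = (\<Sum>j<n. if j = i then (B $$ (i, i))\<^sup>2 else 0)"
  proof (intro sum.cong refl)
    fix j assume "j \<in> {..<n}"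
    with assms have "j < i \<longrightarrow> B $$ (i, j) = 0" "i < j \<longrightarrow> B $$ (j, i) = 0"
      by auto
    then show "B $$ (i, j) * B $$ (j, i) = (if j = i then (B $$ (i, i))\<^sup>2 else 0)"
      by (cases i j rule: linorder_cases) (simp_all add: power2_eq_square)
  qed
  finally show ?thesis
    using assms by simp
qed

text \<open>Each further factor \<open>B\<close> pushes the support one diagonal to the right:
  \<open>B ^\<^sub>m k\<close> lives on the entries with j \<ge> i + k, and none are left when k =
  n.\<close>

lemma strict_upper_triangular_nilpotent:
  assumes B: "B \<in> carrier_mat n n" "\<And>i j. i < n \<Longrightarrow> j \<le> i \<Longrightarrow> B $$ (i, j) = 0"
  shows "B ^\<^sub>m n = 0\<^sub>m n n"
proof -
  have "(B ^\<^sub>m k) $$ (i, j) = 0" if "i < n" "j < n" "j < i + k" for i j k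
    using that
  proof (induction k arbitrary: j)
    case 0
    then show ?case using B by simp
  next
    case (Suc k)
    have "(B ^\<^sub>m Suc k) $$ (i, j) = (\<Sum>l<n. (B ^\<^sub>m k) $$ (i, l) * B $$ (l, j))"
      using B Suc.prems pow_carrier_mat[OF B(1), of k]
      by (simp add: scalar_prod_def lessThan_atLeast0)
    also have "\<dots> = 0"
    proof (intro sum.neutral ballI)
      fix l assume "l \<in> {..<n}"
      \<comment> \<open>If l < i + k, the first factor vanishes by induction. Otherwise j \<le> l,
        since j < i + k + 1, and the second factor vanishes.\<close>
      with Suc B show "(B ^\<^sub>m k) $$ (i, l) * B $$ (l, j) = 0"
        by (cases "l < i + k") auto
    qed
    finally show ?case .
  qed
  then show ?thesis
    using pow_carrier_mat[OF B(1), of n] by (intro eq_matI) auto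
qed

text \<open>A Schur triangular form \<open>B\<close> carries the eigenvalues on its diagonal, so the
  trace of the square is a sum of squares of reals. If its real part is zero, the diagonal of
  \<open>B\<close> vanishes, \<open>B\<close> is nilpotent, and so is \<open>A\<close> by
  similarity.\<close>

lemma real_spectrum_trace_square:
  fixes A :: "complex mat"
  assumes A: "A \<in> carrier_mat n n" and real: "\<And>k. eigenvalue A k \<Longrightarrow> k \<in> \<real>"
  shows "Re (mat_trace (A * A)) \<ge> 0"
    and "Re (mat_trace (A * A)) = 0 \<Longrightarrow> A ^\<^sub>m n = 0\<^sub>m n n"
proof -
  obtain es where "char_poly A = (\<Prod>a\<leftarrow>es. [:- a, 1:])"
    using char_poly_factorized[OF A] by blast
  then obtain B where B: "B \<in> carrier_mat n n" "upper_triangular B" "similar_mat A B"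
    using schur_decomposition_exists[OF A] by blast
  have diag: "B $$ (i, i) \<in> \<real>" if "i < n" for i
  proof -
    have "B $$ (i, i) \<in> set (diag_mat B)"
      using that B by (auto simp: diag_mat_def)
    then have "poly (char_poly A) (B $$ (i, i)) = 0"
      using char_poly_upper_triangular[OF B(1,2)] char_poly_similar[OF B(3)]
      by (simp add: linear_poly_root)
    then show ?thesis
      using real eigenvalue_root_char_poly[OF A] by blast
  qed
  obtain P Q where PQ: "similar_mat_wit A B P Q"
    using B(3) by (auto simp: similar_mat_def)
  have pow: "similar_mat_wit (A ^\<^sub>m k) (B ^\<^sub>m k) P Q" for k
    by (rule similar_mat_wit_pow[OF PQ])
  have "similar_mat (A * A) (B * B)"
    using pow[of 2] A B(1) by (auto simp: similar_mat_def numeral_2_eq_2)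
  then have "mat_trace (A * A) = mat_trace (B * B)"
    by (rule mat_trace_similar)
  also have "\<dots> = (\<Sum>i<n. (B $$ (i, i))\<^sup>2)"
    using B by (auto simp: mat_trace_def upper_triangular_square_diag[OF B(1,2)]
        simp del: index_mult_mat(1) intro!: sum.cong)
  also have "\<dots> = (\<Sum>i<n. complex_of_real ((Re (B $$ (i, i)))\<^sup>2))"
    using diag by (intro sum.cong refl) (simp add: of_real_Re)
  finally have tr: "Re (mat_trace (A * A)) = (\<Sum>i<n. (Re (B $$ (i, i)))\<^sup>2)"
    by simp
  show "Re (mat_trace (A * A)) \<ge> 0"
    by (simp add: tr sum_nonneg)
  assume "Re (mat_trace (A * A)) = 0"
  then have "Re (B $$ (i, i)) = 0" if "i < n" for i
    using that by (simp add: tr sum_nonneg_eq_0_iff)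
  then have "B $$ (i, i) = 0" if "i < n" for i
    using that diag by (metis of_real_0 of_real_Re)
  then have "B $$ (i, j) = 0" if "i < n" "j \<le> i" for i j
    using that B by (cases "j = i") auto
  then have "B ^\<^sub>m n = 0\<^sub>m n n"
    using strict_upper_triangular_nilpotent B(1) by blast
  then show "A ^\<^sub>m n = 0\<^sub>m n n"
    using similar_mat_witD2[OF pow_carrier_mat[OF A] pow[of n]] by auto
qed

section \<open>The left regular representation and its trace\<close>

text \<open>Column \<open>j\<close> of \<open>M x\<close> lists the coordinates of
  \<open>x * bs ! j\<close> in a basis \<open>bs\<close>. The last clause moves eigenvectors of the
  matrix back into the algebra, where the C*-norm controls the eigenvalue.\<close>

lemma left_regular_representation:
  obtains n and M :: "'a::fin_dim_unital_cstar_algebra \<Rightarrow> complex mat"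
  where "\<And>x. M x \<in> carrier_mat n n"
    and "\<And>x y. M (x + y) = M x + M y"
    and "\<And>c x. M (c *\<^sub>C x) = c \<cdot>\<^sub>m M x"
    and "\<And>x y. M (x * y) = M x * M y"
    and "M 1 = 1\<^sub>m n"
    and "\<And>x. M x = 0\<^sub>m n n \<Longrightarrow> x = 0"
    and "\<And>x k. eigenvalue (M x) k \<Longrightarrow> \<exists>w. w \<noteq> 0 \<and> x * w = k *\<^sub>C w"
proof -
  obtain B0 :: "'a set" where B0: "finite B0" "\<And>x. \<exists>c. x = (\<Sum>b\<in>B0. c b *\<^sub>C b)"
    using finite_complex_spanning_set by metis
  have span0: "x \<in> complex_vector.span B0" for x
  proof -
    obtain c where "x = (\<Sum>b\<in>B0. c b *\<^sub>C b)"
      using B0(2) by blast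
    then show ?thesis
      by (simp add: complex_vector.span_sum complex_vector.span_scale complex_vector.span_base)
  qed
  obtain B :: "'a set" where ind: "complex_vector.independent B" and "UNIV \<subseteq> complex_vector.span B"
    using complex_vector.maximal_independent_subset[of UNIV] by metis
  then have span: "x \<in> complex_vector.span B" for x
    by auto
  \<comment> \<open>The finite spanning set bounds the size of every independent set.\<close>
  have finB: "finite B"
    using complex_vector.independent_span_bound[OF B0(1) ind] span0 by auto
  obtain bs where bs: "set bs = B" "distinct bs"
    using finite_distinct_list[OF finB] by blast
  define n where "n = length bs"
  define r where "r x i = complex_vector.representation B x (bs ! i)" for x i
  define M where "M x = mat n n (\<lambda>(i, j). r (x * bs ! j) i)" for x
  have inj: "inj_on ((!) bs) {..<n}" and img: "(!) bs ` {..<n} = B"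
    using bs by (auto simp: n_def inj_on_def nth_eq_iff_index_eq in_set_conv_nth image_iff)
  have expand: "(\<Sum>i<n. r x i *\<^sub>C bs ! i) = x" for x
  proof -
    have "(\<Sum>i<n. r x i *\<^sub>C bs ! i) = (\<Sum>b\<in>B. complex_vector.representation B x b *\<^sub>C b)"
      unfolding r_def img[symmetric] by (subst sum.reindex[OF inj]) (simp add: img)
    also have "\<dots> = x"
      by (rule complex_vector.sum_representation_eq[OF ind span finB subset_refl])
    finally show ?thesis .
  qed
  have r_add: "r (x + y) i = r x i + r y i" for x y i
    by (simp add: r_def complex_vector.representation_add[OF ind span span])
  have r_scale: "r (c *\<^sub>C x) i = c * r x i" for c x i
    by (simp add: r_def complex_vector.representation_scale[OF ind span])
  have r_sum: "r (\<Sum>k\<in>I. f k) i = (\<Sum>k\<in>I. r (f k) i)" for f :: "nat \<Rightarrow> 'a" and I i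
    by (simp add: r_def complex_vector.representation_sum[OF ind span])
  have r_basis: "r (bs ! j) i = (if i = j then 1 else 0)" if "i < n" "j < n" for i j
  proof -
    have "bs ! j \<in> B" using that bs by (auto simp: n_def)
    then show ?thesis
      using that bs by (simp add: r_def complex_vector.representation_basis[OF ind] n_def nth_eq_iff_index_eq)
  qed
  show thesis
  proof
    show carr: "M x \<in> carrier_mat n n" for x by (simp add: M_def)
    show "M (x + y) = M x + M y" for x y
      by (auto simp: M_def r_add distrib_right)
    show "M (c *\<^sub>C x) = c \<cdot>\<^sub>m M x" for c x
      by (auto simp: M_def r_scale mult_scaleC_left)
    show "M 1 = 1\<^sub>m n"
      by (auto simp: M_def r_basis)
    show "M (x * y) = M x * M y" for x y
    proof (rule eq_matI)
      fix i j assume "i < dim_row (M x * M y)" "j < dim_col (M x * M y)"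
      then have ij: "i < n" "j < n" by (simp_all add: M_def)
      have "x * y * bs ! j = x * (\<Sum>k<n. r (y * bs ! j) k *\<^sub>C bs ! k)"
        by (simp add: expand mult.assoc)
      also have "\<dots> = (\<Sum>k<n. r (y * bs ! j) k *\<^sub>C (x * bs ! k))"
        by (simp add: sum_distrib_left mult_scaleC_right)
      finally have "r (x * y * bs ! j) i = (\<Sum>k<n. r (x * bs ! k) i * r (y * bs ! j) k)"
        by (simp add: r_sum r_scale mult.commute)
      then show "M (x * y) $$ (i, j) = (M x * M y) $$ (i, j)"
        using ij by (simp add: M_def scalar_prod_def lessThan_atLeast0)
    qed (simp_all add: M_def)
    show "x = 0" if "M x = 0\<^sub>m n n" for x
    proof -
      have zero: "r (x * bs ! j) i = 0" if "i < n" "j < n" for i j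
        using that arg_cong[OF \<open>M x = 0\<^sub>m n n\<close>, of "\<lambda>A. A $$ (i, j)"] by (simp add: M_def)
      have xb: "x * bs ! j = 0" if "j < n" for j
        using expand[of "x * bs ! j"] zero that by simp
      \<comment> \<open>Left multiplication by \<open>x\<close> kills the basis, hence also the
        unit.\<close>
      have "x = x * (\<Sum>i<n. r 1 i *\<^sub>C bs ! i)"
        by (simp add: expand)
      also have "\<dots> = 0"
        by (simp add: sum_distrib_left mult_scaleC_right xb)
      finally show ?thesis .
    qed
    show "\<exists>w. w \<noteq> 0 \<and> x * w = k *\<^sub>C w" if eig: "eigenvalue (M x) k" for x k
    proof -
      obtain v where v: "v \<in> carrier_vec n" "v \<noteq> 0\<^sub>v n" "M x *\<^sub>v v = k \<cdot>\<^sub>v v"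
        using eig carr[of x] by (auto simp: eigenvalue_def eigenvector_def)
      \<comment> \<open>The element whose coordinate vector is \<open>v\<close>.\<close>
      define w where "w = (\<Sum>j<n. v $ j *\<^sub>C bs ! j)"
      have rw: "r w i = v $ i" if "i < n" for i
        using that by (simp add: w_def r_sum r_scale r_basis if_distrib cong: if_cong)
      have "w \<noteq> 0"
      proof
        assume "w = 0"
        then have "r w i = 0" for i
          using r_scale[of 0 w i] by simp
        then have "v = 0\<^sub>v n"
          using rw v(1) by (intro eq_vecI) auto
        with v show False by simp
      qed
      moreover have "x * w = k *\<^sub>C w"
      proof -
        have "r (x * w) i = r (k *\<^sub>C w) i" if "i < n" for i
        proof -
          have "r (x * w) i = (\<Sum>j<n. r (x * bs ! j) i * v $ j)"
            by (simp add: w_def sum_distrib_left mult_scaleC_right r_sum r_scale mult.commute)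
          also have "\<dots> = (M x *\<^sub>v v) $ i"
            using that v(1) by (simp add: M_def scalar_prod_def lessThan_atLeast0)
          also have "\<dots> = r (k *\<^sub>C w) i"
            using that v by (simp add: r_scale rw)
          finally show ?thesis .
        qed
        then show ?thesis
          by (subst (1 2) expand[symmetric]) simp
      qed
      ultimately show ?thesis by blast
    qed
  qed
qed

text \<open>For faithfulness, \<open>\<tau> (a * a) = 0\<close> with \<open>a\<close> self-adjoint
  makes \<open>M a\<close> nilpotent. As \<open>M\<close> is injective, \<open>a\<close> itself is
  nilpotent, hence zero.\<close>

lemma faithful_trace:
  obtains \<tau> :: "'a::fin_dim_unital_cstar_algebra \<Rightarrow> real"
  where "\<And>x y. \<tau> (x + y) = \<tau> x + \<tau> y"
    and "\<And>r x. \<tau> (r *\<^sub>R x) = r * \<tau> x"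
    and "\<And>x y. \<tau> (x * y) = \<tau> (y * x)"
    and "\<And>x. \<tau> (x\<^sup>\<star> * x) \<ge> 0"
    and "\<And>x. \<tau> (x\<^sup>\<star> * x) = 0 \<Longrightarrow> x = 0"
proof (rule left_regular_representation[where ?'a = 'a])
  fix n and M :: "'a \<Rightarrow> complex mat"
  assume carr: "\<And>x. M x \<in> carrier_mat n n"
      and M_add: "\<And>x y. M (x + y) = M x + M y"
      and M_scale: "\<And>c x. M (c *\<^sub>C x) = c \<cdot>\<^sub>m M x"
      and M_mult: "\<And>x y. M (x * y) = M x * M y"
      and M_1: "M 1 = 1\<^sub>m n"
      and M_0: "\<And>x. M x = 0\<^sub>m n n \<Longrightarrow> x = 0"
      and M_eigen: "\<And>x k. eigenvalue (M x) k \<Longrightarrow> \<exists>w. w \<noteq> 0 \<and> x * w = k *\<^sub>C w"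
  define \<tau> where "\<tau> x = Re (mat_trace (M x))" for x
  have dim: "dim_row (M x) = n" "dim_col (M x) = n" for x
    using carr[of x] by auto
  have add: "\<tau> (x + y) = \<tau> x + \<tau> y" for x y
    by (simp add: \<tau>_def mat_trace_def M_add dim sum.distrib)
  have scale: "\<tau> (r *\<^sub>R x) = r * \<tau> x" for r x
    by (simp add: \<tau>_def mat_trace_def scaleR_scaleC M_scale dim sum_distrib_left)
  have comm: "\<tau> (x * y) = \<tau> (y * x)" for x y
    by (simp add: \<tau>_def M_mult mat_trace_mult_commute[OF carr carr])
  \<comment> \<open>Matrix powers multiply the new factor on the right, so the power in the algebra
    is unfolded by \<open>power_Suc2\<close>.\<close>
  have M_pow: "M (x ^ k) = M x ^\<^sub>m k" for x k
    by (induction k) (simp_all add: M_1 M_mult dim power_Suc2 del: power_Suc)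
  have nonneg: "\<tau> (a * a) \<ge> 0" and faithful: "\<tau> (a * a) = 0 \<Longrightarrow> a = 0" if "a\<^sup>\<star> = a" for a
  proof -
    have "k \<in> \<real>" if "eigenvalue (M a) k" for k
      using M_eigen[OF that] self_adjoint_eigenvalue_real \<open>a\<^sup>\<star> = a\<close> by blast
    note * = real_spectrum_trace_square[OF carr[of a] this]
    show "\<tau> (a * a) \<ge> 0"
      using *(1) by (simp add: \<tau>_def M_mult)
    assume "\<tau> (a * a) = 0"
    then have "M (a ^ n) = 0\<^sub>m n n"
      using *(2) by (simp add: \<tau>_def M_mult M_pow)
    then show "a = 0"
      using M_0 self_adjoint_nilpotent_eq_0 that by blast
  qed
  \<comment> \<open>Up to sign, \<open>u x\<close> and \<open>v x\<close> are twice the real and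
    imaginary parts of \<open>x\<close>. In the sum of their squares the terms \<open>x * x\<close>
    and \<open>x\<^sup>\<star> * x\<^sup>\<star>\<close> cancel.\<close>
  define u where "u x = x + x\<^sup>\<star>" for x :: 'a
  define v where "v x = \<i> *\<^sub>C (x - x\<^sup>\<star>)" for x :: 'a
  have u: "(u x)\<^sup>\<star> = u x" for x
    by (simp add: u_def star_add star_star add.commute)
  have v: "(v x)\<^sup>\<star> = v x" for x
    by (simp add: v_def star_scaleC star_diff star_star complex_vector.scale_right_diff_distrib)
  have "u x * u x + v x * v x = 2 *\<^sub>R (x\<^sup>\<star> * x + x * x\<^sup>\<star>)" for x
    by (simp add: u_def v_def mult_scaleC_left mult_scaleC_right scaleC_scaleC scaleR_2 algebra_simps)
  then have "\<tau> (u x * u x) + \<tau> (v x * v x) = 2 * (\<tau> (x\<^sup>\<star> * x) + \<tau> (x * x\<^sup>\<star>))" for x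
    by (metis add scale)
  then have split: "\<tau> (u x * u x) + \<tau> (v x * v x) = 4 * \<tau> (x\<^sup>\<star> * x)" for x
    using comm[of x "x\<^sup>\<star>"] by simp
  show thesis
  proof
    show "\<tau> (x\<^sup>\<star> * x) \<ge> 0" for x
      using split[of x] nonneg[OF u, of x] nonneg[OF v, of x] by linarith
    show "x = 0" if "\<tau> (x\<^sup>\<star> * x) = 0" for x
    proof -
      have "u x = 0" "v x = 0"
        using split[of x] nonneg[OF u, of x] nonneg[OF v, of x] that
          faithful[OF u, of x] faithful[OF v, of x] by linarith+
      then have "2 *\<^sub>R x = 0"
        by (simp add: u_def v_def scaleR_2)
      then show ?thesis by simp
    qed
  qed (fact add scale comm)+
qed

section \<open>Lines in the cone of sums of squares\<close>

text \<open>Conjugating the line by \<open>y\<close> and applying the trace gives an affine function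
  of t that is nonnegative everywhere, so its slope \<open>\<tau> (y\<^sup>\<star> * H * y)\<close>
  is zero. Suitable choices of \<open>y\<close> then isolate
  \<open>\<tau> (H\<^sup>\<star> * H)\<close>.\<close>

lemma line_of_sums_of_squares_constant:
  fixes H P :: "'a::fin_dim_unital_cstar_algebra"
  assumes H: "H\<^sup>\<star> = H"
    and line: "\<And>t::real. \<exists>z w. t *\<^sub>R H + P = z\<^sup>\<star> * z + w\<^sup>\<star> * w"
  shows "H = 0"
proof (rule faithful_trace[where ?'a = 'a])
  fix \<tau> :: "'a \<Rightarrow> real"
  assume add: "\<And>x y. \<tau> (x + y) = \<tau> x + \<tau> y"
    and scale: "\<And>r x. \<tau> (r *\<^sub>R x) = r * \<tau> x"
    and nonneg: "\<And>x. \<tau> (x\<^sup>\<star> * x) \<ge> 0"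
    and faithful: "\<And>x. \<tau> (x\<^sup>\<star> * x) = 0 \<Longrightarrow> x = 0"
  have conj: "\<tau> (y\<^sup>\<star> * H * y) = 0" for y
  proof (rule ccontr)
    assume nz: "\<tau> (y\<^sup>\<star> * H * y) \<noteq> 0"
    \<comment> \<open>At this point the affine function would take the value -1.\<close>
    define t where "t = - (\<tau> (y\<^sup>\<star> * P * y) + 1) / \<tau> (y\<^sup>\<star> * H * y)"
    obtain z w where zw: "t *\<^sub>R H + P = z\<^sup>\<star> * z + w\<^sup>\<star> * w"
      using line by blast
    have "t *\<^sub>R (y\<^sup>\<star> * H * y) + y\<^sup>\<star> * P * y = y\<^sup>\<star> * (t *\<^sub>R H + P) * y"
      by (simp add: distrib_left distrib_right)
    also have "\<dots> = (z * y)\<^sup>\<star> * (z * y) + (w * y)\<^sup>\<star> * (w * y)"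
      by (simp add: zw star_mult distrib_left distrib_right mult.assoc)
    finally have "t * \<tau> (y\<^sup>\<star> * H * y) + \<tau> (y\<^sup>\<star> * P * y)
        = \<tau> ((z * y)\<^sup>\<star> * (z * y)) + \<tau> ((w * y)\<^sup>\<star> * (w * y))"
      by (simp flip: add scale)
    then have "t * \<tau> (y\<^sup>\<star> * H * y) + \<tau> (y\<^sup>\<star> * P * y) \<ge> 0"
      using nonneg[of "z * y"] nonneg[of "w * y"] by simp
    then show False
      using nz by (simp add: t_def)
  qed
  \<comment> \<open>The vectors 1 + H and 1 - H are compared because the terms H and H^3 cancel in
    the difference, leaving four times H^2.\<close>
  have "4 *\<^sub>R (H\<^sup>\<star> * H) + (1 - H)\<^sup>\<star> * H * (1 - H) = (1 + H)\<^sup>\<star> * H * (1 + H)"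
  proof -
    have "4 *\<^sub>R (H\<^sup>\<star> * H) = H * H + H * H + H * H + H * H"
      using scaleR_add_left[of 2 2 "H * H"] by (simp add: H scaleR_2)
    then show ?thesis
      by (simp add: H star_add star_diff algebra_simps)
  qed
  then have "4 * \<tau> (H\<^sup>\<star> * H) + \<tau> ((1 - H)\<^sup>\<star> * H * (1 - H)) = \<tau> ((1 + H)\<^sup>\<star> * H * (1 + H))"
    by (metis add scale)
  then show "H = 0"
    using conj faithful by simp
qed

section \<open>Schwarz-positive unital maps\<close>

lemma SPU_add: "SPU F \<Longrightarrow> F (x + y) = F x + F y"
  and SPU_diff: "SPU F \<Longrightarrow> F (x - y) = F x - F y"
  and SPU_scaleC: "SPU F \<Longrightarrow> F (c *\<^sub>C x) = c *\<^sub>C F x"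
  by (auto simp: SPU_def simp flip: module_hom_iff_linear
      intro: Modules.module_hom.add Modules.module_hom.diff Modules.module_hom.scale)

lemma SPU_scaleR: "SPU F \<Longrightarrow> F (r *\<^sub>R x) = r *\<^sub>R F x"
  by (simp add: scaleR_scaleC SPU_scaleC)

lemma SPU_schwarz:
  assumes "SPU F"
  obtains y where "F (x\<^sup>\<star> * x) - (F x)\<^sup>\<star> * F x = y\<^sup>\<star> * y"
  using assms by (auto simp: SPU_def cstar_le_def cstar_positive_def)

text \<open>The Schwarz inequality exhibits \<open>F (y\<^sup>\<star> * y)\<close> as a sum of
  squares, hence self-adjoint. Self-adjoint elements are real combinations of such squares, and a
  general \<open>x\<close> is recovered from its real and imaginary parts.\<close>

lemma SPU_star:
  fixes F :: "'b::unital_cstar_algebra \<Rightarrow> 'a::unital_cstar_algebra"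
  assumes F: "SPU F"
  shows "F (x\<^sup>\<star>) = (F x)\<^sup>\<star>"
proof -
  have square: "(F (y\<^sup>\<star> * y))\<^sup>\<star> = F (y\<^sup>\<star> * y)" for y
  proof -
    obtain z where "F (y\<^sup>\<star> * y) - (F y)\<^sup>\<star> * F y = z\<^sup>\<star> * z"
      using SPU_schwarz[OF F] .
    then have "F (y\<^sup>\<star> * y) = (F y)\<^sup>\<star> * F y + z\<^sup>\<star> * z"
      by (simp add: algebra_simps)
    then show ?thesis
      by (simp add: star_add star_mult star_star)
  qed
  have sa: "(F h)\<^sup>\<star> = F h" if "h\<^sup>\<star> = h" for h
  proof -
    \<comment> \<open>Prepares the identity 4 h = (1 + h)^2 - (1 - h)^2, which writes
      \<open>h\<close> through squares.\<close>
    have "4 *\<^sub>R h = h + h + h + h"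
      using scaleR_add_left[of 2 2 h] by (simp add: scaleR_2)
    then have "4 *\<^sub>R h = (1 + h)\<^sup>\<star> * (1 + h) - (1 - h)\<^sup>\<star> * (1 - h)"
      by (simp add: that star_add star_diff algebra_simps)
    then have "4 *\<^sub>R F h = F ((1 + h)\<^sup>\<star> * (1 + h)) - F ((1 - h)\<^sup>\<star> * (1 - h))"
      by (metis SPU_scaleR SPU_diff F)
    then have "(4 *\<^sub>R F h)\<^sup>\<star> = 4 *\<^sub>R F h"
      by (simp only: star_diff[where 'a = 'a] square)
    then show ?thesis
      by (simp add: star_scaleR)
  qed
  have "(F (x + x\<^sup>\<star>))\<^sup>\<star> = F (x + x\<^sup>\<star>)"
    by (rule sa) (simp add: star_add star_star add.commute)
  then have sum: "(F x)\<^sup>\<star> + (F (x\<^sup>\<star>))\<^sup>\<star> = F x + F (x\<^sup>\<star>)"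
    by (simp add: SPU_add[OF F] star_add)
  have "(F (\<i> *\<^sub>C (x - x\<^sup>\<star>)))\<^sup>\<star> = F (\<i> *\<^sub>C (x - x\<^sup>\<star>))"
    by (rule sa) (simp add: star_scaleC star_diff star_star complex_vector.scale_right_diff_distrib)
  then have "\<i> *\<^sub>C ((F (x\<^sup>\<star>))\<^sup>\<star> - (F x)\<^sup>\<star>) = \<i> *\<^sub>C (F x - F (x\<^sup>\<star>))"
    by (simp add: SPU_scaleC[OF F] SPU_diff[OF F] star_scaleC star_diff
        complex_vector.scale_right_diff_distrib)
  then have diff: "(F (x\<^sup>\<star>))\<^sup>\<star> - (F x)\<^sup>\<star> = F x - F (x\<^sup>\<star>)"
    by simp
  have "2 *\<^sub>R F (x\<^sup>\<star>) = (F x + F (x\<^sup>\<star>)) - (F x - F (x\<^sup>\<star>))"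
    by (simp add: scaleR_2)
  also have "\<dots> = 2 *\<^sub>R (F x)\<^sup>\<star>"
    by (simp add: scaleR_2 flip: sum diff)
  finally show ?thesis by simp
qed

section \<open>Vanishing of the Schwarz defect under \<xi>\<close>

theorem lemma8p10:
  fixes G :: "'a::fin_dim_unital_cstar_algebra \<Rightarrow> 'b::fin_dim_unital_cstar_algebra"
    and \<xi> :: "'b \<Rightarrow> 'c::fin_dim_unital_cstar_algebra"
    and A :: 'a
  assumes "SPU G"
    and "SPU \<xi>"
    and "G (A\<^sup>\<star> * A) - (G A)\<^sup>\<star> * G A \<in> ker \<xi>"
  shows "\<forall>D. G (A\<^sup>\<star> * D) - (G A)\<^sup>\<star> * G D \<in> ker \<xi> \<and>
             G (D\<^sup>\<star> * A) - (G D)\<^sup>\<star> * G A \<in> ker \<xi>"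
proof -
  note G = SPU_add[OF assms(1)] SPU_scaleC[OF assms(1)]
  note \<xi> = SPU_add[OF assms(2)] SPU_diff[OF assms(2)] SPU_scaleC[OF assms(2)]
  define S where "S D E = \<xi> (G (D\<^sup>\<star> * E) - (G D)\<^sup>\<star> * G E)" for D E
  have S_add: "S (D + D') E = S D E + S D' E" "S D (E + E') = S D E + S D E'" for D D' E E'
    by (simp_all add: S_def G \<xi> star_add distrib_left distrib_right)
  have S_scale: "S (c *\<^sub>C D) E = cnj c *\<^sub>C S D E" "S D (c *\<^sub>C E) = c *\<^sub>C S D E" for c D E
    by (simp_all add: S_def G \<xi> star_scaleC mult_scaleC_left mult_scaleC_right
        complex_vector.scale_right_diff_distrib)
  have S_star: "(S D E)\<^sup>\<star> = S E D" for D E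
    by (simp add: S_def star_diff star_mult star_star flip: SPU_star[OF assms(1)] SPU_star[OF assms(2)])
  have S_pos: "\<exists>z w. S D D = z\<^sup>\<star> * z + w\<^sup>\<star> * w" for D
  proof -
    \<comment> \<open>The Schwarz defect of \<open>G\<close> at \<open>D\<close> is a square
      \<open>y\<^sup>\<star> * y\<close>; the defect of \<xi> at this \<open>y\<close> supplies the
      second square.\<close>
    obtain y where y: "G (D\<^sup>\<star> * D) - (G D)\<^sup>\<star> * G D = y\<^sup>\<star> * y"
      using SPU_schwarz[OF assms(1)] .
    obtain z where "\<xi> (y\<^sup>\<star> * y) - (\<xi> y)\<^sup>\<star> * \<xi> y = z\<^sup>\<star> * z"
      using SPU_schwarz[OF assms(2)] .
    then have "S D D = z\<^sup>\<star> * z + (\<xi> y)\<^sup>\<star> * \<xi> y"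
      by (simp add: S_def y algebra_simps)
    then show ?thesis by blast
  qed
  have S_AA: "S A A = 0"
    using assms(3) by (simp add: S_def ker_def)
  have anti: "S A D + S D A = 0" for D
  proof (rule line_of_sums_of_squares_constant[where P = "S D D"])
    show "(S A D + S D A)\<^sup>\<star> = S A D + S D A"
      by (simp add: star_add S_star add.commute)
    fix t :: real
    have "t *\<^sub>R (S A D + S D A) + S D D = S (t *\<^sub>R A + D) (t *\<^sub>R A + D)"
      by (simp add: S_add S_scale S_AA scaleR_scaleC scaleC_add_right)
    then show "\<exists>z w. t *\<^sub>R (S A D + S D A) + S D D = z\<^sup>\<star> * z + w\<^sup>\<star> * w"
      using S_pos by simp
  qed
  have "S A D = 0 \<and> S D A = 0" for D
  proof -
    \<comment> \<open>\<open>S\<close> is conjugate-linear in its first argument, so the sum in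
      \<open>anti\<close> becomes a difference.\<close>
    have "\<i> *\<^sub>C (S A D - S D A) = 0"
      using anti[of "\<i> *\<^sub>C D"] by (simp add: S_scale complex_vector.scale_right_diff_distrib)
    then have "S A D = S D A"
      by simp
    with anti[of D] have "2 *\<^sub>R S A D = 0"
      by (simp add: scaleR_2)
    with \<open>S A D = S D A\<close> show ?thesis by simp
  qed
  then show ?thesis
    by (simp add: S_def ker_def)
qed

end
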